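(* Let $p$ be an odd prime, let $q\ge 3$ be an integer, and let $n\ge 0$ be an integer. Then $p^q$ divides $F(p^q,n)$, unless $n$ is of the form $$n=\frac{p^{tq}-1}{p^q-1}\quad\text{for some } t\in\mathbb{N},$$ or of the form $$n=\frac{p^{qt_1+j_1}+\cdots+p^{qt_{m(p-1)+1}+j_{m(p-1)+1}}-1}{p^q-1}$$ for some integer $m$ with $1\le m\le q-1$, some $t_i\in\mathbb{N}$ and some integers $j_i$ with $0\le j_i\le q-1$ ($1\le i\le m(p-1)+1$) satisfying $\sum_{i=1}^{m(p-1)+1}p^{j_i}\equiv 1\pmod{p^q-1}$.
   Context: For integers $s\ge 1$ and $n\ge 0$, the $s$-Catalan number is the integer $F(s,n)=\frac{1}{(s-1)n+1}\binom{sn}{n}$. Here $\mathbb{N}=\{0,1,2,\dots\}$. *)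

theory Defs
  imports Complex_Main "HOL-Number_Theory.Cong" "HOL-Computational_Algebra.Primes"
begin

text \<open>
  The division below is exact for \<open>s \<ge> 1\<close>, see \<open>s_catalan_exact\<close> and \<open>of_nat_s_catalan\<close>.
  The value is kept in \<^typ>\<open>nat\<close> because divisibility is trivial in a field.
\<close>

definition s_catalan :: "nat \<Rightarrow> nat \<Rightarrow> nat" where
  "s_catalan s n = ((s * n) choose n) div ((s - 1) * n + 1)"

lemma s_catalan_exact:
  assumes "s \<ge> 1"
  shows "(s - 1) * n + 1 dvd ((s * n) choose n)"
proof -
  have eq: "s * n = (s - 1) * n + n"
    using assms by (cases s) auto
  have "(s * n + 1 - n) * ((s * n + 1) choose n) = (s * n + 1) * ((s * n) choose n)"
    using binomial_absorb_comp[of "s * n + 1" n] by simp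
  moreover have "s * n + 1 - n = (s - 1) * n + 1"
    using eq by simp
  ultimately have d: "(s - 1) * n + 1 dvd (s * n + 1) * ((s * n) choose n)"
    by (metis dvd_triv_left)
  have "coprime ((s - 1) * n + 1) n"
    by (metis coprime_add_one_left coprime_commute coprime_mult_right_iff mult.commute)
  moreover have "s * n + 1 = ((s - 1) * n + 1) + n"
    using eq by simp
  ultimately have "coprime ((s - 1) * n + 1) (s * n + 1)"
    by (metis coprime_iff_gcd_eq_1 gcd_add2)
  with d show ?thesis
    using coprime_dvd_mult_right_iff by blast
qed

lemma of_nat_s_catalan:
  assumes "s \<ge> 1"
  shows "(of_nat (s_catalan s n) :: rat) =
    1 / ((of_nat s - 1) * of_nat n + 1) * of_nat ((s * n) choose n)"
proof -
  have "(of_nat ((s - 1) * n + 1) :: rat) = (of_nat s - 1) * of_nat n + 1"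
    using assms by (simp add: of_nat_diff)
  thus ?thesis
    unfolding s_catalan_def using s_catalan_exact[OF assms, of n]
    by (metis mult.commute mult.right_neutral of_nat_of_nat_div times_divide_eq_right)
qed

end

theory Submission
  imports Defs
begin

text \<open>
  Put \<open>N = (p ^ q - 1) * n + 1\<close>.  The \<open>s\<close>-Catalan number \<open>F\<close> for \<open>s = p ^ q\<close> satisfies
  \<open>F * n! * N! = (p ^ q * n)!\<close>.  Legendre's formula says that \<open>p - 1\<close> times the exponent
  of \<open>p\<close> in \<open>k!\<close> is \<open>k\<close> minus the sum of the base-\<open>p\<close> digits of \<open>k\<close>.  As \<open>p ^ q * n\<close> and
  \<open>n\<close> have the same digit sum, everything cancels except the digit sum of \<open>N\<close>
  (lemma \<open>multiplicity_s_catalan\<close>): if \<open>p\<close> occurs in \<open>F\<close> with exponent \<open>v\<close>, then \<open>N\<close> has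
  digit sum \<open>v * (p - 1) + 1\<close>.

  Hence \<open>N\<close> is a sum of \<open>v * (p - 1) + 1\<close> powers of \<open>p\<close> (lemma
  \<open>sum_of_digit_sum_powers\<close>).  Divide the exponents by \<open>q\<close> with remainder, so that the powers
  are \<open>p ^ (q * t\<^sub>i + j\<^sub>i)\<close>.  Since \<open>p ^ q\<close> and \<open>N\<close> are both \<open>1\<close> modulo \<open>p ^ q - 1\<close>, the
  \<open>p ^ j\<^sub>i\<close> add up to \<open>1\<close> modulo \<open>p ^ q - 1\<close>.  If \<open>p ^ q\<close> does not divide \<open>F\<close> then \<open>v < q\<close>:
  the case \<open>v = 0\<close> is the first exceptional form, because then \<open>p ^ j\<^sub>1 = 1\<close>, and \<open>v \<ge> 1\<close>
  is the second one with \<open>m = v\<close>.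
\<close>

text \<open>
  The guard \<open>p \<le> 1\<close> is there for termination only: in these bases the value is a dummy.
\<close>
fun digit_sum :: "nat \<Rightarrow> nat \<Rightarrow> nat" where
  "digit_sum p n = (if p \<le> 1 \<or> n = 0 then 0 else n mod p + digit_sum p (n div p))"

declare digit_sum.simps [simp del]

lemma digit_sum_0 [simp]: "digit_sum p 0 = 0"
  by (simp add: digit_sum.simps)

lemma digit_sum_mult_add:
  assumes "r < p" and "p > 1"
  shows "digit_sum p (p * u + r) = r + digit_sum p u"
  using assms by (subst digit_sum.simps) auto

lemma digit_sum_power_mult:
  assumes "p > 1"
  shows "digit_sum p (p ^ k * n) = digit_sum p n"
proof (induction k)
  case (Suc k)
  then show ?case
    using digit_sum_mult_add[of 0 p "p ^ k * n"] assms by (simp add: mult.assoc)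
qed simp

text \<open>Passing from \<open>k\<close> to \<open>k + 1\<close> turns each trailing digit \<open>p - 1\<close> into \<open>0\<close> and adds one to
  the next digit; the number of carries is the exponent of \<open>p\<close> in \<open>k + 1\<close>.\<close>
lemma digit_sum_Suc:
  assumes "prime p"
  shows "digit_sum p (Suc k) + (p - 1) * multiplicity p (Suc k) = digit_sum p k + 1"
proof (induction k rule: less_induct)
  case (less k)
  have p: "p > 1" using assms prime_gt_1_nat by blast
  show ?case
  proof (cases "p dvd Suc k")
    case True
    then obtain u where u: "Suc k = p * u" by blast
    then obtain l where l: "u = Suc l" by (cases u) auto
    have k: "k = p * l + (p - 1)" using u l p by simp
    have "l < k"
    proof -
      have "1 * l \<le> p * l" using p by (intro mult_le_mono) auto
      then show ?thesis using k p by linarith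
    qed
    then have IH: "digit_sum p u + (p - 1) * multiplicity p u = digit_sum p l + 1"
      using less l by simp
    have "digit_sum p k = (p - 1) + digit_sum p l"
      unfolding k using p by (intro digit_sum_mult_add) auto
    moreover have "digit_sum p (Suc k) = digit_sum p u"
      using digit_sum_mult_add[of 0 p u] u p by simp
    moreover have "multiplicity p (Suc k) = Suc (multiplicity p u)"
      unfolding u using l p by (intro multiplicity_times_same) auto
    ultimately show ?thesis using IH by simp
  next
    case False
    define r where "r = k mod p"
    have k: "k = p * (k div p) + r" by (simp add: r_def)
    have "r < p" using p by (simp add: r_def)
    moreover have "Suc r \<noteq> p"
    proof
      assume "Suc r = p"
      then have "Suc k = p * (k div p) + p" using k by linarith
      then have "Suc k = p * Suc (k div p)" by simp
      with False show False by (metis dvd_triv_left)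
    qed
    ultimately have r: "Suc r < p" by simp
    have "digit_sum p (Suc k) = Suc r + digit_sum p (k div p)"
      using digit_sum_mult_add[OF r p, of "k div p"] k by simp
    moreover have "digit_sum p k = r + digit_sum p (k div p)"
      using digit_sum_mult_add[of r p "k div p"] k r p by simp
    moreover have "multiplicity p (Suc k) = 0"
      using False by (rule not_dvd_imp_multiplicity_0)
    ultimately show ?thesis by simp
  qed
qed

text \<open>Legendre's formula: the increments of both sides agree by \<open>digit_sum_Suc\<close>.\<close>
lemma multiplicity_fact_digit_sum:
  fixes p :: nat
  assumes "prime p"
  shows "(p - 1) * multiplicity p (fact k :: nat) + digit_sum p k = k"
proof (induction k)
  case (Suc k)
  have "multiplicity p (fact (Suc k) :: nat) =
      multiplicity p (Suc k) + multiplicity p (fact k :: nat)"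
    unfolding fact_Suc using assms by (subst prime_elem_multiplicity_mult_distrib) auto
  then show ?case
    using Suc digit_sum_Suc[OF assms, of k] by (simp add: algebra_simps)
qed simp

lemma s_catalan_mult_fact:
  assumes "s \<ge> 1"
  shows "s_catalan s n * fact n * fact ((s - 1) * n + 1) = fact (s * n)"
proof -
  have eq: "s * n = (s - 1) * n + n" using assms by (cases s) auto
  have C: "s_catalan s n * ((s - 1) * n + 1) = (s * n) choose n"
    unfolding s_catalan_def using s_catalan_exact[OF assms] by (rule dvd_div_mult_self)
  have "fact n * fact ((s - 1) * n) * ((s * n) choose n) = fact (s * n)"
    using binomial_fact_lemma[of n "s * n"] eq by simp
  then show ?thesis unfolding C[symmetric] by (simp add: algebra_simps)
qed

text \<open>Multiplying by \<open>p ^ q\<close> appends zeros, so the digit sums of \<open>p ^ q * n\<close> and \<open>n\<close> cancel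
  in Legendre's formula.  The final \<open>+ 1\<close> is the excess of \<open>N + n\<close> over \<open>p ^ q * n\<close>.\<close>
lemma multiplicity_s_catalan:
  assumes p: "prime p"
  shows "digit_sum p ((p ^ q - 1) * n + 1) = multiplicity p (s_catalan (p ^ q) n) * (p - 1) + 1"
proof -
  define N where "N = (p ^ q - 1) * n + 1"
  define F where "F = s_catalan (p ^ q) n"
  have p1: "p > 1" using p prime_gt_1_nat by blast
  have FN: "F * fact n * fact N = fact (p ^ q * n)"
    unfolding F_def N_def using p1 by (intro s_catalan_mult_fact) simp
  then have "F \<noteq> 0" by (metis fact_nonzero mult_zero_left)
  then have "multiplicity p F + multiplicity p (fact n :: nat) + multiplicity p (fact N :: nat)
      = multiplicity p (fact (p ^ q * n) :: nat)"
    unfolding FN[symmetric] using p by (simp add: prime_elem_multiplicity_mult_distrib)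
  then have "(p - 1) * multiplicity p F + (p - 1) * multiplicity p (fact n :: nat)
      + (p - 1) * multiplicity p (fact N :: nat) = (p - 1) * multiplicity p (fact (p ^ q * n) :: nat)"
    by (metis distrib_left)
  moreover have "N + n = p ^ q * n + 1"
  proof -
    have "p ^ q * n = (p ^ q - 1) * n + n" using p1 by (cases "p ^ q") auto
    then show ?thesis by (simp add: N_def)
  qed
  ultimately have "digit_sum p N = (p - 1) * multiplicity p F + 1"
    using multiplicity_fact_digit_sum[OF p, of n] multiplicity_fact_digit_sum[OF p, of N]
      multiplicity_fact_digit_sum[OF p, of "p ^ q * n"] digit_sum_power_mult[OF p1, of q n]
    by linarith
  then show ?thesis by (simp add: N_def F_def mult.commute)
qed

text \<open>Each digit \<open>d\<close> at position \<open>e\<close> contributes \<open>d\<close> copies of \<open>p ^ e\<close>.\<close>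
lemma sum_list_of_digit_sum_powers:
  assumes "p > 1"
  shows "\<exists>es. length es = digit_sum p n \<and> (\<Sum>e\<leftarrow>es. p ^ e) = n"
proof (induction n rule: less_induct)
  case (less n)
  show ?case
  proof (cases "n = 0")
    case False
    with assms less obtain es where es: "length es = digit_sum p (n div p)"
      "(\<Sum>e\<leftarrow>es. p ^ e) = n div p" by (metis div_less_dividend neq0_conv)
    have "(\<Sum>e\<leftarrow>es. p ^ Suc e) = p * (n div p)"
      unfolding es(2)[symmetric] by (simp add: sum_list_const_mult)
    then have "(\<Sum>e\<leftarrow>replicate (n mod p) 0 @ map Suc es. p ^ e) = n"
      by (simp add: sum_list_replicate o_def)
    moreover have "length (replicate (n mod p) 0 @ map Suc es) = digit_sum p n"
      using es(1) False assms by (simp add: digit_sum.simps[of p n])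
    ultimately show ?thesis by blast
  qed simp
qed

lemma sum_of_digit_sum_powers:
  assumes "p > 1"
  obtains e :: "nat \<Rightarrow> nat" where "(\<Sum>i = 1..digit_sum p n. p ^ e i) = n"
proof -
  obtain es where es: "length es = digit_sum p n" "(\<Sum>e\<leftarrow>es. p ^ e) = n"
    using sum_list_of_digit_sum_powers[OF assms] by blast
  have "n = (\<Sum>i = 0..<digit_sum p n. p ^ (es ! i))"
    using es by (simp add: sum_list_sum_nth)
  also have "\<dots> = (\<Sum>i = 1..digit_sum p n. p ^ (es ! (i - 1)))"
    by (rule sum.reindex_bij_witness[of _ "\<lambda>i. i - 1" Suc]) auto
  finally show ?thesis using that[of "\<lambda>i. es ! (i - 1)"] by simp
qed

theorem theorem10:
  fixes p q n :: nat
  assumes "prime p" and "odd p" and "q \<ge> 3"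
    and not_first: "\<not> (\<exists>t::nat.
      (of_nat n :: rat) = (of_nat p ^ (t * q) - 1) / (of_nat p ^ q - 1))"
    and not_second: "\<not> (\<exists>(m::nat) (t :: nat \<Rightarrow> nat) (j :: nat \<Rightarrow> nat).
      1 \<le> m \<and> m \<le> q - 1 \<and>
      (\<forall>i\<in>{1..m * (p - 1) + 1}. j i \<le> q - 1) \<and>
      [(\<Sum>i = 1..m * (p - 1) + 1. p ^ j i) = 1] (mod (p ^ q - 1)) \<and>
      (of_nat n :: rat) =
        ((\<Sum>i = 1..m * (p - 1) + 1. of_nat p ^ (q * t i + j i)) - 1) / (of_nat p ^ q - 1))"
  shows "p ^ q dvd s_catalan (p ^ q) n"
proof (rule ccontr)
  assume not_dvd: "\<not> p ^ q dvd s_catalan (p ^ q) n"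
  define m where "m = multiplicity p (s_catalan (p ^ q) n)"
  define N where "N = (p ^ q - 1) * n + 1"
  have p1: "p > 1" using \<open>prime p\<close> prime_gt_1_nat by blast
  have pq: "p ^ q > 1" using p1 \<open>q \<ge> 3\<close> by (intro one_less_power) auto
  have "m < q" using not_dvd multiplicity_dvd' unfolding m_def by (meson not_le)
  have "digit_sum p N = m * (p - 1) + 1"
    unfolding N_def m_def using multiplicity_s_catalan[OF \<open>prime p\<close>] .
  then obtain e where e: "(\<Sum>i = 1..m * (p - 1) + 1. p ^ e i) = N"
    using sum_of_digit_sum_powers[OF p1, of N] by metis
  define t j where "t = (\<lambda>i. e i div q)" and "j = (\<lambda>i. e i mod q)"
  have e_eq: "e i = q * t i + j i" for i by (simp add: t_def j_def)
  have j_le: "j i \<le> q - 1" for i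
    using mod_less_divisor[of q "e i"] \<open>q \<ge> 3\<close> unfolding j_def by linarith
  have "[p ^ q = 1] (mod (p ^ q - 1))"
    unfolding cong_def
    using mod_add_self2[of 1 "p ^ q - 1"] le_add_diff_inverse[of 1 "p ^ q"] pq
    by (metis less_imp_le)
  then have "[(p ^ q) ^ t i * p ^ j i = 1 ^ t i * p ^ j i] (mod (p ^ q - 1))" for i
    by (intro cong_mult cong_pow) auto
  then have "[p ^ e i = p ^ j i] (mod (p ^ q - 1))" for i
    by (simp add: e_eq power_add power_mult)
  then have "[N = (\<Sum>i = 1..m * (p - 1) + 1. p ^ j i)] (mod (p ^ q - 1))"
    unfolding e[symmetric] by (intro cong_sum)
  moreover have "[N = 1] (mod (p ^ q - 1))"
    unfolding N_def cong_def by (metis add.commute mod_mult_self2)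
  ultimately have cong: "[(\<Sum>i = 1..m * (p - 1) + 1. p ^ j i) = 1] (mod (p ^ q - 1))"
    using cong_sym cong_trans by blast
  have ne: "(of_nat p ^ q - 1 :: rat) \<noteq> 0"
    using pq by (metis eq_iff_diff_eq_0 less_irrefl of_nat_1 of_nat_eq_iff of_nat_power)
  have "(of_nat N :: rat) = (of_nat p ^ q - 1) * of_nat n + 1"
    using pq by (simp add: N_def of_nat_diff)
  then have n_eq: "(of_nat n :: rat) = (of_nat N - 1) / (of_nat p ^ q - 1)"
    using ne by (simp add: field_simps)
  show False
  proof (cases "m = 0")
    case True
    \<comment> \<open>Only \<open>p ^ j 1\<close> is left in the sum; it lies below the modulus, so that the congruence
      is an equation.\<close>
    have "p ^ j 1 \<le> p ^ (q - 1)" using p1 j_le by (intro power_increasing) auto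
    also have "p ^ (q - 1) < p ^ q - 1"
    proof -
      have "p ^ q = p * p ^ (q - 1)" using \<open>q \<ge> 3\<close> by (cases q) auto
      moreover have "2 * p ^ (q - 1) \<le> p * p ^ (q - 1)" using p1 by (intro mult_le_mono) auto
      moreover have "p ^ (q - 1) > 1" using p1 \<open>q \<ge> 3\<close> by (intro one_less_power) auto
      ultimately show ?thesis by linarith
    qed
    finally have "p ^ j 1 < p ^ q - 1" .
    moreover from this have "1 < p ^ q - 1"
      using p1 by (metis le_less_trans one_le_power less_imp_le)
    moreover have "[p ^ j 1 = 1] (mod (p ^ q - 1))" using cong True by simp
    ultimately have "p ^ j 1 = 1" using cong_less_modulus_unique_nat by blast
    then have "j 1 = 0" using p1 by simp
    then have "N = p ^ (t 1 * q)" using e True by (simp add: e_eq mult.commute)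
    then show False using n_eq not_first by auto
  next
    case False
    have "(of_nat N :: rat) = (\<Sum>i = 1..m * (p - 1) + 1. of_nat p ^ (q * t i + j i))"
      unfolding e[symmetric] e_eq by simp
    with n_eq have "(of_nat n :: rat) =
        ((\<Sum>i = 1..m * (p - 1) + 1. of_nat p ^ (q * t i + j i)) - 1) / (of_nat p ^ q - 1)"
      by simp
    moreover have "1 \<le> m" "m \<le> q - 1" using False \<open>m < q\<close> by auto
    ultimately show False using j_le cong not_second by blast
  qed
qed

end
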